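(* For all $\tau\in\mathbb{H}$, $$X^4(\tau) = w(\tau)\bigl(1-3w(\tau)+3w(\tau)^2\bigr), \qquad X^4(3\tau) = \dfrac{w(\tau)^3}{1-3w(\tau)+3w(\tau)^2}.$$
   Context: $\mathbb{H}$ is the complex upper half-plane and, for $\tau\in\mathbb{H}$, $q=e^{2\pi i\tau}$ and $q^{r}=e^{2\pi i r\tau}$ for rational $r$. The Dedekind eta function is $\eta(\tau)=q^{1/24}\prod_{n=1}^\infty(1-q^n)$. The function $X$ (a continued fraction of order six) is $$X(\tau)=q^{1/4}\prod_{n=1}^{\infty}\dfrac{(1-q^{6n-1})(1-q^{6n-5})}{(1-q^{6n-2})(1-q^{6n-4})}=\dfrac{\eta(\tau)\eta^2(6\tau)}{\eta^2(2\tau)\eta(3\tau)},$$ and $w(\tau):=X(\tau)X(3\tau)$. Here $f^k(\tau)$ denotes $f(\tau)^k$. *)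

theory Defs
  imports "HOL-Analysis.Analysis"
begin

text \<open>The power $q^r = e^{2\pi i r\tau}$ of the nome, for rational $r$; it is single-valued in
  $\tau$, and no branch of a root of $q$ is involved.\<close>

definition qpow :: "rat \<Rightarrow> complex \<Rightarrow> complex" where
  "qpow r \<tau> = exp (2 * of_real pi * \<i> * of_rat r * \<tau>)"

text \<open>The infinite product in the definition of $X$ starts at $n = 1$, whereas \<open>\<Prod>n\<close> starts
  at \<open>0\<close>; hence \<open>Suc n\<close>. The natural-number subtractions never truncate. For
  \<open>Im \<tau> > 0\<close> we have \<open>0 < norm q < 1\<close>, so no factor vanishes and the product converges;
  outside the upper half-plane the value is not meaningful.\<close>

definition X :: "complex \<Rightarrow> complex" where
  "X \<tau> = qpow (1/4) \<tau> *
     (let q = qpow 1 \<tau> in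
      \<Prod>n. ((1 - q ^ (6 * Suc n - 1)) * (1 - q ^ (6 * Suc n - 5))) /
           ((1 - q ^ (6 * Suc n - 2)) * (1 - q ^ (6 * Suc n - 4))))"

definition w :: "complex \<Rightarrow> complex" where
  "w \<tau> = X \<tau> * X (3 * \<tau>)"

end

theory Submission
  imports Defs
begin

text \<open>
  Everything is expressed through one theta function, Ramanujan's
  $\psi(q) = \sum_{n\ge 0} q^{n(n+1)/2}$. By Gauss's identity it equals the product
  $\prod_{n\ge 1} (1-q^{2n})/(1-q^{2n-1})$, and sorting the factors by their residue modulo 6
  gives $X(\tau) = q^{1/4}\psi(q^3)/\psi(q)$ (\<open>X_eq_psi_quotient\<close>). Hence $\psi(q^3)$ cancels in
  $w = q\,\psi(q^9)/\psi(q)$, and after multiplication by $\psi(q)^4/q$ the first formula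
  becomes the cubic relation
  \[ \bigl((\psi(q)-B)^3 + B^3\bigr)\,\psi(q^9) = \psi(q^3)^4, \qquad B = q\,\psi(q^9), \]
  because $1-3w+3w^2 = (1-w)^3+w^3$. This is \<open>psi_cubic_relation\<close>. The second formula follows from
  the first one by dividing $w^4 = X^4(\tau)X^4(3\tau)$ by it.

  The cubic relation comes from looking at $\psi$ on the three points $q, cq, c^2q$, with $c$ a
  primitive cube root of unity, in two ways.

  Series: the triangular number $n(n+1)/2$ is divisible by 3 unless $n = 3m+1$, when it is
  $9m(m+1)/2+1$. So $\psi(q) = A + B$ where $A$ is a power series in $q^3$, and $\psi$ takes the values
  $A+B$, $A+cB$, $A+c^2B$, whose product is $A^3+B^3$ (\<open>psi_three_dissection\<close>).

  Product: $(1-q^n)(1-(cq)^n)(1-(c^2q)^n)$ is $1-q^{3n}$ if $3\nmid n$ and $(1-q^n)^3$ if $3\mid n$, so the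
  product of the three values is $\psi(q^3)^4/\psi(q^9)$ (\<open>psi_rotation_product\<close>).

  The only analytic input is Gauss's identity (\<open>gauss_psi_product\<close>), which is the limit of a finite
  identity due to Shanks (\<open>shanks_identity\<close>) that telescopes.
\<close>

section \<open>The theta function and its partial products\<close>

definition psi_partial :: "nat \<Rightarrow> complex \<Rightarrow> complex" where
  "psi_partial n q = (\<Prod>j<n. (1 - q ^ (2*j+2)) / (1 - q ^ (2*j+1)))"

text \<open>Ramanujan's theta function; the exponents are the triangular numbers.\<close>

definition psi :: "complex \<Rightarrow> complex" where
  "psi q = (\<Sum>n. q ^ (n * (n+1) div 2))"

lemma one_minus_power_nonzero:
  fixes q :: complex
  assumes "norm q < 1" "n > 0"
  shows "1 - q ^ n \<noteq> 0"
proof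
  assume "1 - q ^ n = 0"
  hence "norm q ^ n = 1" by (metis norm_one norm_power right_minus_eq)
  moreover have "norm q ^ n < 1" using assms by (simp add: power_less_one_iff)
  ultimately show False by simp
qed

lemma psi_partial_Suc:
  "psi_partial (Suc n) q = psi_partial n q * ((1 - q ^ (2*n+2)) / (1 - q ^ (2*n+1)))"
  by (simp add: psi_partial_def)

lemma psi_partial_nonzero:
  assumes "norm q < 1"
  shows "psi_partial n q \<noteq> 0"
  unfolding psi_partial_def
  using one_minus_power_nonzero[OF assms]
  by (auto simp del: power_Suc power_Suc2)

text \<open>Three consecutive factors are grouped because this makes exponents run through the residues
  modulo 6, the form in which the factors are compared both with the product defining $X$ and
  with the product over the three cube roots of unity.\<close>

lemma psi_partial_triple:
  "psi_partial (3 * n) q = (\<Prod>k<n.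
     ((1 - q ^ (6*k+2)) * (1 - q ^ (6*k+4)) * (1 - q ^ (6*k+6))) /
     ((1 - q ^ (6*k+1)) * (1 - q ^ (6*k+3)) * (1 - q ^ (6*k+5))))"
proof (induction n)
  case 0
  show ?case by (simp add: psi_partial_def)
next
  case (Suc n)
  have "3 * Suc n = Suc (Suc (Suc (3*n)))" by simp
  hence "psi_partial (3 * Suc n) q = psi_partial (3*n) q *
     ((1 - q ^ (2*(3*n)+2)) / (1 - q ^ (2*(3*n)+1))) *
     ((1 - q ^ (2*Suc (3*n)+2)) / (1 - q ^ (2*Suc (3*n)+1))) *
     ((1 - q ^ (2*Suc (Suc (3*n))+2)) / (1 - q ^ (2*Suc (Suc (3*n))+1)))"
    by (simp only: psi_partial_Suc)
  also have "2*(3*n)+2 = 6*n+2" by simp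
  also have "2*(3*n)+1 = 6*n+1" by simp
  also have "2*Suc (3*n)+2 = 6*n+4" by simp
  also have "2*Suc (3*n)+1 = 6*n+3" by simp
  also have "2*Suc (Suc (3*n))+2 = 6*n+6" by simp
  also have "2*Suc (Suc (3*n))+1 = 6*n+5" by simp
  finally show ?case unfolding Suc.IH prod.lessThan_Suc by (simp only: times_divide_times_eq mult.assoc)
qed

text \<open>The limit is not identified at this stage. That it is nonzero matters: the argument for
  Gauss's identity divides by partial products and needs their inverses to be bounded, and the
  nonvanishing of $\psi$ on the disc is inherited from here.\<close>

lemma psi_partial_converges:
  assumes "norm q < 1"
  obtains L where "(\<lambda>n. psi_partial n q) \<longlonglongrightarrow> L" "L \<noteq> 0"
proof -
  have *: "\<exists>L. (\<lambda>n. \<Prod>j<n. 1 - q ^ (2*j+Suc c)) \<longlonglongrightarrow> L \<and> L \<noteq> 0" for c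
  proof -
    have "summable (\<lambda>j. norm q ^ (2*j+Suc c))"
    proof (rule summable_comparison_test')
      show "summable (\<lambda>j. norm q ^ j)" using assms by (simp add: summable_geometric)
      show "norm (norm q ^ (2*j+Suc c)) \<le> norm q ^ j" if "j \<ge> 0" for j
        unfolding real_norm_def power_abs abs_norm_cancel by (rule power_decreasing) (use assms in auto)
    qed
    hence "abs_convergent_prod (\<lambda>j. 1 - q ^ (2*j+Suc c))"
      by (intro summable_imp_abs_convergent_prod) (simp add: norm_mult norm_power)
    hence "convergent_prod (\<lambda>j. 1 - q ^ (2*j+Suc c))"
      by (rule abs_convergent_prod_imp_convergent_prod)
    moreover have "1 - q ^ (2*j+Suc c) \<noteq> 0" for j
      using one_minus_power_nonzero[OF assms, of "2*j+Suc c"] by blast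
    ultimately have "(\<lambda>n. \<Prod>j\<le>n. 1 - q ^ (2*j+Suc c)) \<longlonglongrightarrow> prodinf (\<lambda>j. 1 - q ^ (2*j+Suc c))"
      "prodinf (\<lambda>j. 1 - q ^ (2*j+Suc c)) \<noteq> 0"
      using convergent_prod_LIMSEQ prodinf_nonzero by blast+
    thus ?thesis
      unfolding LIMSEQ_lessThan_iff_atMost[of "\<lambda>A. \<Prod>j\<in>A. 1 - q ^ (2*j+Suc c)"] by blast
  qed
  obtain L0 L1 where L: "(\<lambda>n. \<Prod>j<n. 1 - q ^ (2*j+Suc 0)) \<longlonglongrightarrow> L0" "L0 \<noteq> 0"
    "(\<lambda>n. \<Prod>j<n. 1 - q ^ (2*j+Suc 1)) \<longlonglongrightarrow> L1" "L1 \<noteq> 0"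
    using *[of 0] *[of 1] by blast
  have "(\<lambda>n. psi_partial n q) \<longlonglongrightarrow> L1 / L0"
    using tendsto_divide[OF L(3) L(1) L(2)]
    by (simp add: psi_partial_def prod_dividef del: power_Suc)
  thus ?thesis using L that by auto
qed

section \<open>Gauss's product for the theta function\<close>

text \<open>Shanks's finite form of Gauss's identity. As $n$ grows, the term $s = 0$ tends to the infinite
  product and all others are of size $O(|q|^{2n+1})$.

  The proof is by induction on $n$. The right-hand side grows by two triangular powers. On the
  left, the new term $s = n+1$ is the second of them, and the change in the terms $s \le n$
  telescopes to the first.\<close>

lemma shanks_identity:
  assumes q: "norm q < 1"
  shows "(\<Sum>s\<le>n. psi_partial n q / psi_partial s q * q ^ (s * (2*n+1)))
           = (\<Sum>k\<le>2*n. q ^ (k * (k+1) div 2))"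
proof (induction n)
  case 0
  show ?case by (simp add: psi_partial_def)
next
  case (Suc n)
  define F where "F m s = psi_partial m q / psi_partial s q * q ^ (s * (2*m+1))" for m s :: nat
  \<comment> \<open>The function whose differences are the changes of the old terms, up to the factor
    $1-q^{2n+1}$. It vanishes at 0, and at $n+1$ it gives the odd-indexed triangular power.\<close>
  define h where "h s = F n s * (1 - q ^ (2 * s))" for s
  have nz: "psi_partial k q \<noteq> 0" for k by (rule psi_partial_nonzero[OF q])
  have od: "1 - q ^ (2*k+1) \<noteq> 0" for k by (rule one_minus_power_nonzero[OF q]) simp
  have ev: "1 - q ^ (2*k+2) \<noteq> 0" for k by (rule one_minus_power_nonzero[OF q]) simp
  have step: "(1 - q ^ (2*n+1)) * (F (Suc n) s - F n s) = h (Suc s) - h s" for s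
  proof -
    have "q ^ (s * (2 * Suc n + 1)) = q ^ (s * (2*n+1)) * q ^ (2 * s)"
      by (simp add: power_add[symmetric] algebra_simps)
    moreover have alg: "a * (p * (e / a) / r * (u * v)) = p / r * u * e * v" if "a \<noteq> 0"
      for a e p r u v :: complex using that by simp
    ultimately have 1: "(1 - q ^ (2*n+1)) * F (Suc n) s = F n s * (1 - q ^ (2*n+2)) * q ^ (2 * s)"
      unfolding F_def psi_partial_Suc by (simp only: alg[OF od])
    have a: "q ^ (Suc s * (2*n+1)) = q ^ (s * (2*n+1)) * q ^ (2*n+1)"
      by (simp add: power_add[symmetric] algebra_simps)
    have b: "2 * Suc s = 2 * s+2" by simp
    have 2: "h (Suc s) = F n s * (1 - q ^ (2 * s+1)) * q ^ (2*n+1)"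
      unfolding F_def psi_partial_Suc h_def a b using od[of s] ev[of s] nz[of s]
      by (simp add: divide_simps)
    have c: "q ^ (2*n+2) = q * q ^ (2*n+1)" "q ^ (2 * s+1) = q * q ^ (2 * s)" by simp_all
    show ?thesis unfolding right_diff_distrib 1 2 unfolding h_def c by (simp only: algebra_simps mult_1_left)
  qed
  have "(1 - q ^ (2*n+1)) * ((\<Sum>s\<le>n. F (Suc n) s) - (\<Sum>s\<le>n. F n s)) = (\<Sum>s\<le>n. h (Suc s) - h s)"
    by (simp only: sum_subtractf[symmetric] sum_distrib_left step)
  also have "\<dots> = h (Suc n) - h 0"
    using sum_lessThan_telescope[of h "Suc n"] by (simp only: lessThan_Suc_atMost)
  also have "\<dots> = (1 - q ^ (2*n+1)) * q ^ (Suc n * (2*n+1))"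
  proof -
    have b: "2 * Suc n = 2*n+2" by simp
    show ?thesis
      unfolding h_def F_def psi_partial_Suc b using od[of n] ev[of n] nz[of n]
      by (simp add: divide_simps)
  qed
  finally have "(\<Sum>s\<le>n. F (Suc n) s) - (\<Sum>s\<le>n. F n s) = q ^ (Suc n * (2*n+1))"
    using od[of n] mult_left_cancel by blast
  hence "(\<Sum>s\<le>n. F (Suc n) s) = (\<Sum>s\<le>n. F n s) + q ^ (Suc n * (2*n+1))"
    by (simp only: diff_eq_eq add.commute)
  moreover have "F (Suc n) (Suc n) = q ^ (Suc n * (2 * Suc n + 1))"
    using nz[of "Suc n"] by (simp only: F_def) simp
  ultimately have "(\<Sum>s\<le>Suc n. F (Suc n) s) = 
      (\<Sum>s\<le>n. F n s) + q ^ (Suc n * (2*n+1)) + q ^ (Suc n * (2 * Suc n + 1))"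
    by simp
  also have "(\<Sum>s\<le>n. F n s) = (\<Sum>k\<le>2*n. q ^ (k * (k+1) div 2))"
    using Suc.IH by (simp only: F_def)
  also have "Suc n * (2*n+1) = Suc (2*n) * (Suc (2*n) + 1) div 2"
  proof -
    have "Suc (2*n) * (Suc (2*n) + 1) = 2 * (Suc n * (2*n+1))" by simp
    thus ?thesis by (metis nonzero_mult_div_cancel_left zero_neq_numeral)
  qed
  also have "Suc n * (2*Suc n+1) = Suc (Suc (2*n)) * (Suc (Suc (2*n)) + 1) div 2"
  proof -
    have "Suc (Suc (2*n)) * (Suc (Suc (2*n)) + 1) = 2 * (Suc n * (2*Suc n+1))" by simp
    thus ?thesis by (metis nonzero_mult_div_cancel_left zero_neq_numeral)
  qed
  also have "(\<Sum>k\<le>2*n. q ^ (k * (k+1) div 2)) + q ^ (Suc (2*n) * (Suc (2*n) + 1) div 2) 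
      + q ^ (Suc (Suc (2*n)) * (Suc (Suc (2*n)) + 1) div 2) 
      = (\<Sum>k\<le>Suc (Suc (2*n)). q ^ (k * (k+1) div 2))"
    by (simp only: sum.atMost_Suc)
  also have "Suc (Suc (2*n)) = 2 * Suc n" by simp
  finally show ?case by (simp only: F_def)
qed

lemma psi_sums:
  assumes "norm q < 1"
  shows "(\<lambda>n. q ^ (n * (n+1) div 2)) sums psi q"
proof -
  have "summable (\<lambda>n. q ^ (n * (n+1) div 2))"
  proof (rule summable_comparison_test')
    show "summable (\<lambda>n. norm q ^ n)" using assms by (simp add: summable_geometric)
    show "norm (q ^ (n * (n+1) div 2)) \<le> norm q ^ n" if "n \<ge> 0" for n
    proof -
      have "n * 2 \<le> n * (n+1)" by (cases n) auto
      hence "n \<le> n * (n+1) div 2" by linarith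
      thus ?thesis using assms by (auto simp: norm_power intro!: power_decreasing)
    qed
  qed
  thus ?thesis unfolding psi_def by (rule summable_sums)
qed

text \<open>In Shanks's identity the quotients of partial products are bounded, uniformly in both
  indices, as the partial products converge to a nonzero limit; this controls the terms
  $s \ge 1$. The partial sums with an even upper bound are enough, since the series converges.\<close>

lemma gauss_psi_product:
  assumes q: "norm q < 1"
  shows "(\<lambda>n. psi_partial n q) \<longlonglongrightarrow> psi q" "psi q \<noteq> 0"
proof -
  obtain L where L: "(\<lambda>n. psi_partial n q) \<longlonglongrightarrow> L" "L \<noteq> 0"
    using psi_partial_converges[OF q] .
  have Li: "(\<lambda>n. inverse (psi_partial n q)) \<longlonglongrightarrow> inverse L"
    by (intro tendsto_inverse L)
  obtain C where C: "C > 0" "\<And>n. norm (psi_partial n q) \<le> C"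
    using convergent_imp_Bseq[OF convergentI[OF L(1)]] unfolding Bseq_def by auto
  obtain D where D: "D > 0" "\<And>n. norm (inverse (psi_partial n q)) \<le> D"
    using convergent_imp_Bseq[OF convergentI[OF Li]] unfolding Bseq_def by auto
  define E where "E n = (\<Sum>s=1..n. psi_partial n q / psi_partial s q * q ^ (s * (2*n+1)))" for n
  have split: "(\<Sum>k\<le>2*n. q ^ (k * (k+1) div 2)) = psi_partial n q + E n" for n
  proof -
    have "{..n} = insert 0 {1..n}" by auto
    hence "(\<Sum>s\<le>n. psi_partial n q / psi_partial s q * q ^ (s * (2*n+1))) = psi_partial n q + E n"
      unfolding E_def by (simp add: psi_partial_def[of 0])
    thus ?thesis using shanks_identity[OF q, of n] by simp
  qed
  have bound: "norm (E n) \<le> C * D * (of_nat n * norm q ^ n)" for n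
  proof -
    have "norm (E n) \<le> (\<Sum>s=1..n. C * D * norm q ^ n)"
      unfolding E_def
    proof (rule sum_norm_le)
      fix s assume s: "s \<in> {1..n}"
      \<comment> \<open>A crude bound suffices: the $n$ terms then contribute $n|q|^n$, which tends to 0.\<close>
      have "norm q ^ (s * (2*n+1)) \<le> norm q ^ n"
      proof (rule power_decreasing)
        have "1 * n \<le> s * (2*n+1)" using s by (intro mult_mono) auto
        thus "n \<le> s * (2*n+1)" by simp
      qed (use q in auto)
      hence "norm (psi_partial n q) * norm (inverse (psi_partial s q)) * norm q ^ (s * (2*n+1))
          \<le> C * D * norm q ^ n"
        using C D by (intro mult_mono) (auto simp: less_imp_le)
      thus "norm (psi_partial n q / psi_partial s q * q ^ (s * (2*n+1))) \<le> C * D * norm q ^ n"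
        by (simp only: norm_mult norm_power divide_inverse)
    qed
    thus ?thesis by (simp add: mult_ac)
  qed
  have "(\<lambda>n. C * D * (of_nat n * norm q ^ n)) \<longlonglongrightarrow> C * D * 0"
    using q by (intro tendsto_mult tendsto_const powser_times_n_limit_0) simp
  hence "(\<lambda>n. C * D * (of_nat n * norm q ^ n)) \<longlonglongrightarrow> 0" by simp
  hence "E \<longlonglongrightarrow> 0"
    by (rule Lim_null_comparison[OF always_eventually, rotated]) (use bound in blast)
  hence "(\<lambda>n. psi_partial n q + E n) \<longlonglongrightarrow> L + 0" by (intro tendsto_add L)
  hence "(\<lambda>n. \<Sum>k\<le>2*n. q ^ (k * (k+1) div 2)) \<longlonglongrightarrow> L" by (simp only: split add_0_right)
  moreover have "(\<lambda>n. \<Sum>k\<le>2*n. q ^ (k * (k+1) div 2)) \<longlonglongrightarrow> psi q"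
  proof -
    have "(\<lambda>n. \<Sum>k\<le>n. q ^ (k * (k+1) div 2)) \<longlonglongrightarrow> psi q"
      using psi_sums[OF q] by (simp only: sums_def_le)
    from LIMSEQ_subseq_LIMSEQ[OF this, of "\<lambda>n. 2*n"] show ?thesis
      by (simp add: strict_mono_def o_def)
  qed
  ultimately have "L = psi q" by (rule LIMSEQ_unique)
  thus "(\<lambda>n. psi_partial n q) \<longlonglongrightarrow> psi q" "psi q \<noteq> 0" using L by auto
qed

lemma psi_partial_subseq:
  assumes "norm q < 1" 
  shows "(\<lambda>n. psi_partial (3*n) q) \<longlonglongrightarrow> psi q"
  using LIMSEQ_subseq_LIMSEQ[OF gauss_psi_product(1)[OF assms], of "\<lambda>n. 3*n"]
  by (simp add: strict_mono_def o_def)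

section \<open>The cubic relation\<close>

text \<open>The difference $A(q) = \psi(q) - q\,\psi(q^9)$ removes from the series exactly the exponents not
  divisible by 3, so it is a power series in $q^3$ and does not change when $q$ is multiplied by a
  cube root of unity. As $(cq)^9 = q^9$, the statement is $A(cq) = A(q)$.\<close>

lemma psi_three_dissection:
  assumes q: "norm q < 1" and c: "c ^ 3 = 1"
  shows "psi (c * q) - c * q * psi (q ^ 9) = psi q - q * psi (q ^ 9)"
proof -
  have normc: "norm c = 1"
    using c by (metis norm_one norm_power norm_ge_zero power_eq_1_iff zero_neq_numeral)
  \<comment> \<open>The terms of the series with index congruent to 0 or 2 modulo 3.\<close>
  define A where "A z N = (\<Sum>m<N. z ^ (3*m * (3*m+1) div 2) + z ^ ((3*m+2) * (3*m+3) div 2))"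
    for z :: complex and N
  have conv: "A z \<longlonglongrightarrow> psi z - z * psi (z ^ 9)" if z: "norm z < 1" for z
  proof -
    have "norm (z ^ 9) < 1" using z by (simp add: norm_power power_less_one_iff)
    note s9 = psi_sums[OF this, unfolded sums_def]
    have "(\<lambda>N. \<Sum>n<3*N. z ^ (n * (n+1) div 2)) \<longlonglongrightarrow> psi z"
      using LIMSEQ_subseq_LIMSEQ[OF psi_sums[OF z, unfolded sums_def], of "\<lambda>n. 3*n"]
      by (simp add: strict_mono_def o_def)
    from tendsto_diff[OF this tendsto_mult[OF tendsto_const[of z] s9]]
    have "(\<lambda>N. (\<Sum>n<3*N. z ^ (n * (n+1) div 2)) - z * (\<Sum>n<N. (z ^ 9) ^ (n * (n+1) div 2)))
        \<longlonglongrightarrow> psi z - z * psi (z ^ 9)" .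
    moreover have "(\<Sum>n<3*N. z ^ (n * (n+1) div 2)) - z * (\<Sum>n<N. (z ^ 9) ^ (n * (n+1) div 2)) = A z N" for N
    proof (induction N)
      case 0 show ?case by (simp add: A_def)
    next
      case (Suc N)
      have e: "3 * Suc N = Suc (Suc (Suc (3*N)))" by simp
      have "even (N * (N+1))" by simp
      then obtain t where t: "N * (N+1) = 2 * t" by (rule evenE)
      have "(3*N+1) * (3*N+2) = 9 * (N * (N+1)) + 2" by algebra
      hence "(3*N+1) * (3*N+2) = 2 * (9 * t + 1)" unfolding t by simp
      hence f: "(3*N+1) * (3*N+2) div 2 = 9 * t + 1" by simp
      have g: "N * (N+1) div 2 = t" unfolding t by simp
      have h: "Suc (3*N) * (Suc (3*N) + 1) = (3*N+1) * (3*N+2)"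
         "Suc (Suc (3*N)) * (Suc (Suc (3*N)) + 1) = (3*N+2) * (3*N+3)" by (simp_all add: algebra_simps)
      have alg: "(s + a + b + d) - z * (t + u) = (s - z * t) + a + b + d - z * u"
        for s a b d t u :: complex by (simp add: algebra_simps)
      have "(\<Sum>n<3*Suc N. z ^ (n * (n+1) div 2)) - z * (\<Sum>n<Suc N. (z ^ 9) ^ (n * (n+1) div 2))
         = A z N + z ^ (3*N * (3*N+1) div 2) + z ^ ((3*N+1) * (3*N+2) div 2)
           + z ^ ((3*N+2) * (3*N+3) div 2) - z * (z ^ 9) ^ (N * (N+1) div 2)"
        unfolding e sum.lessThan_Suc Suc.IH[symmetric] h by (rule alg)
      also have "\<dots> = A z (Suc N)"
        unfolding f g A_def by (simp add: power_mult[symmetric])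
      finally show ?case .
    qed
    ultimately show ?thesis by (simp only:)
  qed
  have "A (c * q) = A q"
  proof
    fix N
    have cp: "(c * q) ^ (3 * k) = q ^ (3 * k)" for k
      by (simp add: power_mult power_mult_distrib c)
    have d1: "(c * q) ^ (3*m * (3*m+1) div 2) = q ^ (3*m * (3*m+1) div 2)" for m
    proof -
      have "3*m * (3*m+1) div 2 = 3 * (m * (3*m+1) div 2)"
        using div_mult_swap[of 2 "m * (3*m+1)" 3] by (simp add: mult.assoc)
      thus ?thesis using cp by metis
    qed
    have d2: "(c * q) ^ ((3*m+2) * (3*m+3) div 2) = q ^ ((3*m+2) * (3*m+3) div 2)" for m
    proof -
      have "(3*m+2) * (3*m+3) = 3 * ((3*m+2) * (m+1))" by (simp add: algebra_simps)
      moreover have "even ((3*m+2) * (m+1))" by simp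
      ultimately have "(3*m+2) * (3*m+3) div 2 = 3 * ((3*m+2) * (m+1) div 2)"
        using div_mult_swap[of 2 "(3*m+2) * (m+1)" 3] by simp
      thus ?thesis using cp by metis
    qed
    show "A (c * q) N = A q N" unfolding A_def d1 d2 ..
  qed
  moreover have "norm (c * q) < 1" using q normc by (simp add: norm_mult)
  ultimately have "A q \<longlonglongrightarrow> psi (c * q) - c * q * psi ((c * q) ^ 9)"
    using conv[of "c * q"] by simp
  moreover have "(c * q) ^ 9 = q ^ 9"
    using power_mult[of c 3 3] c by (simp add: power_mult_distrib)
  ultimately show ?thesis using LIMSEQ_unique[OF _ conv[OF q]] by simp
qed

lemma cube_root_of_unity:
  fixes c :: complex
  assumes "c\<^sup>2 + c + 1 = 0"
  shows "c ^ 3 = 1"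
proof -
  have "c ^ 3 - 1 = (c\<^sup>2 + c + 1) * (c - 1)"
    by (simp add: algebra_simps power2_eq_square power3_eq_cube)
  thus ?thesis using assms by simp
qed

lemma cube_root_of_unity_products:
  fixes c z :: complex
  assumes c: "c\<^sup>2 + c + 1 = 0"
  shows "(a + b) * (a + c * b) * (a + c\<^sup>2 * b) = a ^ 3 + b ^ 3"
    and "(1 - z) * (1 - c * z) * (1 - c\<^sup>2 * z) = 1 - z ^ 3"
proof -
  have g: "(a + b) * (a + c * b) * (a + c\<^sup>2 * b) = a ^ 3 + b ^ 3" for a b :: complex
  proof -
    have "(a + b) * (a + c * b) * (a + c\<^sup>2 * b) - (a ^ 3 + b ^ 3)
       = (c\<^sup>2 + c + 1) * (a\<^sup>2 * b + a * b\<^sup>2 * c + b ^ 3 * (c - 1))"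
      by (simp add: algebra_simps power2_eq_square power3_eq_cube)
    thus ?thesis using c by simp
  qed
  show "(a + b) * (a + c * b) * (a + c\<^sup>2 * b) = a ^ 3 + b ^ 3" by (rule g)
  show "(1 - z) * (1 - c * z) * (1 - c\<^sup>2 * z) = 1 - z ^ 3"
    using g[of 1 "-z"] by (simp add: power3_eq_cube)
qed

text \<open>The identity already holds between partial products, when the argument $q^9$ gets a third
  as many factors as the rotated arguments. Taken over the three rotations, a factor
  $1-q^n$ with $3\nmid n$ yields $1-(q^3)^n$, a factor of $\psi(q^3)$; with $n = 3m$ it yields
  $(1-(q^3)^m)^3$. Multiplying by the product for $\psi(q^9)$ supplies the factors
  $1-(q^3)^n$, $3\mid n$, that are missing from one full copy of $\psi(q^3)$, and the cubes make up three
  more copies.\<close>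

lemma psi_rotation_product:
  assumes q: "norm q < 1" and c: "c\<^sup>2 + c + 1 = 0"
  shows "psi q * psi (c * q) * psi (c\<^sup>2 * q) * psi (q ^ 9) = psi (q ^ 3) ^ 4"
proof -
  have c3: "c ^ 3 = 1" using c by (rule cube_root_of_unity)
  have normc: "norm c = 1"
    using c3 by (metis norm_one norm_power norm_ge_zero power_eq_1_iff zero_neq_numeral)
  have nc: "norm (c * q) < 1" "norm (c\<^sup>2 * q) < 1" 
    using q normc by (simp_all add: norm_mult norm_power)
  have q9: "norm (q ^ 9) < 1" and q3: "norm (q ^ 3) < 1"
    using q by (simp_all add: norm_power power_less_one_iff)
  \<comment> \<open>What becomes of $1-q^n$ under the product over the three rotations.\<close>
  define R where "R n = (1 - q ^ n) * (1 - (c * q) ^ n) * (1 - (c\<^sup>2 * q) ^ n)" for n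
  have R0: "R (3 * k) = (1 - (q ^ 3) ^ k) ^ 3" for k
  proof -
    have a: "c ^ (3*k) = 1" by (simp add: power_mult c3)
    have b: "(c\<^sup>2) ^ (3*k) = 1" using a by (metis mult.commute power_mult power_one)
    show ?thesis
      unfolding R_def power_mult_distrib a b power_mult[of q 3 k] by (simp only: mult_1 power3_eq_cube mult.assoc)
  qed
  have R1: "R (3 * k + 1) = 1 - (q ^ 3) ^ (3 * k + 1)" 
   and R2: "R (3 * k + 2) = 1 - (q ^ 3) ^ (3 * k + 2)" for k
  proof -
    have ck: "c ^ (3*k+1) = c" "c ^ (3*k+2) = c\<^sup>2" by (simp_all add: power_add power_mult c3 power2_eq_square)
    have cc: "(c\<^sup>2)\<^sup>2 = c" using c3 by (simp add: power2_eq_square power3_eq_cube mult.assoc)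
    have ck': "(c\<^sup>2) ^ (3*k+1) = c\<^sup>2" "(c\<^sup>2) ^ (3*k+2) = c"
      using ck cc by (metis mult.commute power_mult)+
    show "R (3 * k + 1) = 1 - (q ^ 3) ^ (3 * k + 1)"
      unfolding R_def power_mult_distrib ck ck' cube_root_of_unity_products(2)[OF c]
      by (simp only: power_mult[symmetric] mult.commute)
    show "R (3 * k + 2) = 1 - (q ^ 3) ^ (3 * k + 2)"
      using cube_root_of_unity_products(2)[OF c, of "q ^ (3*k+2)"]
      unfolding R_def power_mult_distrib ck ck'
      by (simp only: power_mult[symmetric] mult_ac)
  qed
  have finite: "psi_partial (3*n) q * psi_partial (3*n) (c * q) * psi_partial (3*n) (c\<^sup>2 * q)
       * psi_partial n (q ^ 9) = psi_partial (3*n) (q ^ 3) * psi_partial n (q ^ 3) ^ 3" for n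
  proof -
    have "psi_partial (3*n) q * psi_partial (3*n) (c * q) * psi_partial (3*n) (c\<^sup>2 * q)
       = (\<Prod>k<n. R (6*k+2) * R (6*k+4) * R (6*k+6) / (R (6*k+1) * R (6*k+3) * R (6*k+5)))"
      unfolding psi_partial_triple R_def prod.distrib[symmetric]
      by (simp only: times_divide_times_eq mult_ac)
    also have "\<dots> * psi_partial n (q ^ 9) = psi_partial (3*n) (q ^ 3) * psi_partial n (q ^ 3) ^ 3"
      unfolding psi_partial_triple unfolding psi_partial_def prod_power_distrib prod.distrib[symmetric]
    proof (rule prod.cong[OF refl])
      fix k :: nat
      have i: "6*k+2 = 3*(2*k)+2" "6*k+4 = 3*(2*k+1)+1" "6*k+6 = 3*(2*k+2)" 
        "6*k+1 = 3*(2*k)+1" "6*k+3 = 3*(2*k+1)" "6*k+5 = 3*(2*k+1)+2" by simp_all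
      have j: "(q ^ 9) ^ m = (q ^ 3) ^ (3 * m)" for m by (simp add: power_mult[symmetric])
      \<comment> \<open>In this regrouping $a_i = 1-(q^3)^{6k+i}$, $b_6 = 1-(q^3)^{2k+2}$, $b_3 = 1-(q^3)^{2k+1}$.\<close>
      have alg: "(a2 * a4 * b6 ^ 3) / (a1 * b3 ^ 3 * a5) * (a6 / a3)
          = (a2 * a4 * a6) / (a1 * a3 * a5) * (b6 / b3) ^ 3" 
        for a1 a2 a3 a4 a5 a6 b3 b6 :: complex
        by (simp only: times_divide_times_eq power_divide mult_ac)
      show "R (6*k+2) * R (6*k+4) * R (6*k+6) / (R (6*k+1) * R (6*k+3) * R (6*k+5)) 
          * ((1 - (q ^ 9) ^ (2*k+2)) / (1 - (q ^ 9) ^ (2*k+1))) =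
          (1 - (q ^ 3) ^ (6*k+2)) * (1 - (q ^ 3) ^ (6*k+4)) * (1 - (q ^ 3) ^ (6*k+6)) /
          ((1 - (q ^ 3) ^ (6*k+1)) * (1 - (q ^ 3) ^ (6*k+3)) * (1 - (q ^ 3) ^ (6*k+5))) *
          ((1 - (q ^ 3) ^ (2*k+2)) / (1 - (q ^ 3) ^ (2*k+1))) ^ 3"
        unfolding i R0 R1 R2 j by (rule alg)
    qed
    finally show ?thesis .
  qed
  have "(\<lambda>n. psi_partial (3*n) q * psi_partial (3*n) (c * q) * psi_partial (3*n) (c\<^sup>2 * q)
       * psi_partial n (q ^ 9)) \<longlonglongrightarrow> psi q * psi (c * q) * psi (c\<^sup>2 * q) * psi (q ^ 9)"
    by (intro tendsto_mult psi_partial_subseq gauss_psi_product q nc q9)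
  moreover have "(\<lambda>n. psi_partial (3*n) (q ^ 3) * psi_partial n (q ^ 3) ^ 3) 
      \<longlonglongrightarrow> psi (q ^ 3) * psi (q ^ 3) ^ 3"
    by (intro tendsto_mult tendsto_power psi_partial_subseq gauss_psi_product q3)
  ultimately have "psi q * psi (c * q) * psi (c\<^sup>2 * q) * psi (q ^ 9) = psi (q ^ 3) * psi (q ^ 3) ^ 3"
    unfolding finite by (rule LIMSEQ_unique)
  thus ?thesis by (simp add: power_Suc[symmetric])
qed

lemma psi_cubic_relation:
  assumes q: "norm q < 1"
  shows "((psi q - q * psi (q ^ 9)) ^ 3 + (q * psi (q ^ 9)) ^ 3) * psi (q ^ 9) = psi (q ^ 3) ^ 4"
proof -
  define c where "c = Complex (-1/2) (sqrt 3 / 2)"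
  have c: "c\<^sup>2 + c + 1 = 0"
    by (simp add: c_def complex_eq_iff power2_eq_square)
  have c3: "c ^ 3 = 1" using c by (rule cube_root_of_unity)
  have c6: "(c\<^sup>2) ^ 3 = 1"
    using c3 by (metis mult.commute power_mult power_one)
  define a b where "a = psi q - q * psi (q ^ 9)" and "b = q * psi (q ^ 9)"
  have "psi q = a + b" "psi (c * q) = a + c * b" "psi (c\<^sup>2 * q) = a + c\<^sup>2 * b"
    using psi_three_dissection[OF q c3] psi_three_dissection[OF q c6]
    by (simp_all add: a_def b_def algebra_simps)
  hence "psi q * psi (c * q) * psi (c\<^sup>2 * q) = a ^ 3 + b ^ 3"
    using cube_root_of_unity_products(1)[OF c] by simp
  thus ?thesis using psi_rotation_product[OF q c] unfolding a_def b_def by simp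
qed

section \<open>The continued fraction as a theta quotient\<close>

text \<open>Among the factors of $\psi(q)$, those whose exponent is a multiple of 3 form $\psi(q^3)$; dividing
  leaves the exponents $\pm 1$ modulo 6 in the numerator and $\pm 2$ modulo 6 in the denominator.
  The match is exact for partial products with $N$ and $3N$ factors.\<close>

lemma X_eq_psi_quotient:
  assumes q: "norm (qpow 1 \<tau>) < 1"
  shows "X \<tau> = qpow (1/4) \<tau> * (psi (qpow 1 \<tau> ^ 3) / psi (qpow 1 \<tau>))"
proof -
  define q where "q = qpow 1 \<tau>"
  note q = q[folded q_def]
  have q3: "norm (q ^ 3) < 1" using q by (simp add: norm_power power_less_one_iff)
  let ?f = "\<lambda>n. ((1 - q ^ (6 * Suc n - 1)) * (1 - q ^ (6 * Suc n - 5))) /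
           ((1 - q ^ (6 * Suc n - 2)) * (1 - q ^ (6 * Suc n - 4)))"
  have partial: "(\<Prod>n<N. ?f n) = psi_partial N (q ^ 3) / psi_partial (3*N) q" for N
  proof -
    have "psi_partial N (q ^ 3) / psi_partial (3*N) q = (\<Prod>k<N. ?f k)"
      unfolding psi_partial_triple unfolding psi_partial_def prod_dividef[symmetric]
    proof (rule prod.cong[OF refl])
      fix k :: nat
      have i: "6 * Suc k - 1 = 6*k+5" "6 * Suc k - 5 = 6*k+1" "6 * Suc k - 2 = 6*k+4" 
         "6 * Suc k - 4 = 6*k+2" by simp_all
      have j: "(q ^ 3) ^ (2*k+2) = q ^ (6*k+6)" "(q ^ 3) ^ (2*k+1) = q ^ (6*k+3)"
        by (simp_all only: power_mult[symmetric]) (simp_all add: algebra_simps)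
      have nz: "1 - q ^ (6*k+m) \<noteq> 0" if "m > 0" for m 
        by (rule one_minus_power_nonzero[OF q]) (use that in simp)
      have alg: "(a6 / a3) / ((a2 * a4 * a6) / (a1 * a3 * a5)) = (a5 * a1) / (a4 * a2)"
        if "a3 \<noteq> 0" "a6 \<noteq> 0" for a1 a2 a3 a4 a5 a6 :: complex
        using that by (simp add: divide_simps)
      show "((1 - (q ^ 3) ^ (2*k+2)) / (1 - (q ^ 3) ^ (2*k+1))) /
          ((1 - q ^ (6*k+2)) * (1 - q ^ (6*k+4)) * (1 - q ^ (6*k+6)) /
           ((1 - q ^ (6*k+1)) * (1 - q ^ (6*k+3)) * (1 - q ^ (6*k+5)))) = ?f k"
        unfolding i j by (rule alg) (rule nz, simp)+
    qed
    thus ?thesis ..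
  qed
  have "(\<lambda>N. psi_partial N (q ^ 3) / psi_partial (3*N) q) \<longlonglongrightarrow> psi (q ^ 3) / psi q"
    by (intro tendsto_divide psi_partial_subseq gauss_psi_product q q3)
  hence "(\<lambda>N. \<Prod>n\<le>N. ?f n) \<longlonglongrightarrow> psi (q ^ 3) / psi q"
    unfolding partial[symmetric] by (simp only: LIMSEQ_lessThan_iff_atMost[of "\<lambda>A. prod ?f A"])
  \<comment> \<open>Convergence of an infinite product means convergence to a nonzero limit, hence the use of
    the nonvanishing of $\psi$.\<close>
  hence "raw_has_prod ?f 0 (psi (q ^ 3) / psi q)"
    using gauss_psi_product(2)[OF q] gauss_psi_product(2)[OF q3] 
    by (simp add: raw_has_prod_def)
  hence "?f has_prod (psi (q ^ 3) / psi q)" by (simp add: has_prod_def)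
  hence "prodinf ?f = psi (q ^ 3) / psi q" by (rule has_prod_unique[symmetric])
  thus ?thesis unfolding X_def Let_def q_def[symmetric] by (simp only:)
qed

theorem theorem1p1:
  fixes \<tau> :: complex
  assumes "Im \<tau> > 0"
  shows "X \<tau> ^ 4 = w \<tau> * (1 - 3 * w \<tau> + 3 * (w \<tau>)\<^sup>2)
       \<and> X (3 * \<tau>) ^ 4 = w \<tau> ^ 3 / (1 - 3 * w \<tau> + 3 * (w \<tau>)\<^sup>2)"
proof -
  define q e where "q = qpow 1 \<tau>" and "e = qpow (1/4) \<tau>"
  have q: "norm q < 1" using assms by (simp add: q_def qpow_def)
  have q3: "norm (q ^ 3) < 1" and q9: "norm (q ^ 9) < 1"
    using q by (simp_all add: norm_power power_less_one_iff)
  have e4: "e ^ 4 = q" 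
    by (simp add: q_def e_def qpow_def of_rat_divide mult_ac flip: exp_of_nat_mult)
  have e0: "e \<noteq> 0" by (simp add: e_def qpow_def)
  have Q3: "qpow 1 (3 * \<tau>) = q ^ 3" and E3: "qpow (1/4) (3 * \<tau>) = e ^ 3"
    by (simp_all add: q_def e_def qpow_def mult_ac flip: exp_of_nat_mult)
  define p1 p3 p9 where "p1 = psi q" and "p3 = psi (q ^ 3)" and "p9 = psi (q ^ 9)"
  have nz: "p1 \<noteq> 0" "p3 \<noteq> 0" "p9 \<noteq> 0"
    unfolding p1_def p3_def p9_def by (intro gauss_psi_product q q3 q9)+
  have x: "X \<tau> = e * (p3 / p1)"
    using X_eq_psi_quotient[of \<tau>] q by (simp add: q_def e_def p1_def p3_def)
  have "X (3 * \<tau>) = e ^ 3 * (psi ((q ^ 3) ^ 3) / psi (q ^ 3))"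
    using X_eq_psi_quotient[of "3 * \<tau>"] q3 unfolding Q3 E3 by simp
  hence y: "X (3 * \<tau>) = e ^ 3 * (p9 / p3)"
    by (simp add: p3_def p9_def power_mult[symmetric])
  have "w \<tau> = e ^ 4 * p9 / p1"
    unfolding w_def x y using nz by (simp add: field_simps power_Suc[symmetric] eval_nat_numeral)
  hence w: "w \<tau> = q * p9 / p1" by (simp only: e4)
  have rel: "((p1 - q * p9) ^ 3 + (q * p9) ^ 3) * p9 = p3 ^ 4"
    using psi_cubic_relation[OF q] by (simp only: p1_def p3_def p9_def)
  have "w \<tau> * (1 - 3 * w \<tau> + 3 * (w \<tau>)\<^sup>2) = q * (((p1 - q * p9) ^ 3 + (q * p9) ^ 3) * p9) / p1 ^ 4"
    unfolding w using nz by (simp add: field_simps power2_eq_square power3_eq_cube power4_eq_xxxx)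
  also have "\<dots> = X \<tau> ^ 4"
    unfolding rel x using e4 by (simp add: power_mult_distrib power_divide)
  finally have first: "X \<tau> ^ 4 = w \<tau> * (1 - 3 * w \<tau> + 3 * (w \<tau>)\<^sup>2)" ..
  have x0: "X \<tau> \<noteq> 0" using x nz e0 by simp
  hence f0: "w \<tau> \<noteq> 0" "1 - 3 * w \<tau> + 3 * (w \<tau>)\<^sup>2 \<noteq> 0" using first by auto
  have "w \<tau> * (w \<tau>) ^ 3 = X \<tau> ^ 4 * X (3 * \<tau>) ^ 4"
    unfolding w_def by (simp add: power_mult_distrib power4_eq_xxxx power3_eq_cube mult_ac)
  also have "\<dots> = w \<tau> * ((1 - 3 * w \<tau> + 3 * (w \<tau>)\<^sup>2) * X (3 * \<tau>) ^ 4)"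
    unfolding first by (simp only: mult.assoc)
  finally have "(w \<tau>) ^ 3 = (1 - 3 * w \<tau> + 3 * (w \<tau>)\<^sup>2) * X (3 * \<tau>) ^ 4"
    using f0 mult_left_cancel by blast
  hence "X (3 * \<tau>) ^ 4 = w \<tau> ^ 3 / (1 - 3 * w \<tau> + 3 * (w \<tau>)\<^sup>2)"
    using f0 by (simp add: field_simps)
  with first show ?thesis by blast
qed

end
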